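(* Let $G'$ and $H$ be two non-trivial graphs such that $G'$ is connected ($H$ need not be connected). Then: 1. If $r(G' \circ H) \ge 2$, then $r(G' \circ H) \le rc(G' \circ H) \le 2\,r(G' \circ H)$. This bound is tight: there exist non-trivial graphs $G'$ and $H$, with $G'$ connected and $r(G'\circ H)\ge 2$, such that $rc(G' \circ H) = 2\,r(G' \circ H)$. 2. If $r(G' \circ H) = 1$, then $1 \le rc(G' \circ H) \le 3$. This bound is tight: there exist non-trivial graphs $G'$ and $H$, with $G'$ connected and $r(G'\circ H)=1$, such that $rc(G' \circ H) = 3$.
   Context: All graphs are finite, simple and undirected. A graph is trivial if it has order (number of vertices) 0 or 1, and non-trivial otherwise. For a connected graph $G$: $dist_G(u,v)$ is the length (number of edges) of a shortest path between $u$ and $v$; the eccentricity of a vertex $v$ is $ecc(v)=\max\{dist_G(v,u): u\in V(G)\}$; the radius is $r(G)=\min\{ecc(v): v\in V(G)\}$. An edge coloring of $G$ is any function from $E(G)$ to a set of colors (not necessarily proper). A path is a rainbow path if no two of its edges have the same color. An edge coloring is a rainbow coloring if every pair of vertices is connected by at least one rainbow path. The rainbow connection number $rc(G)$ of a connected graph $G$ is the minimum number of colors in a rainbow coloring of $G$. The lexicographic product $G \circ H$ has vertex set $V(G)\times V(H)$; two distinct vertices $[g_1,h_1]$ and $[g_2,h_2]$ are adjacent if and only if either $(g_1,g_2)\in E(G)$, or $g_1=g_2$ and $(h_1,h_2)\in E(H)$. (If $G$ is connected and non-trivial and $H$ is non-empty, then $G\circ H$ is connected.) *)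

theory Defs
  imports "Graph_Theory.Graph_Theory"
begin

text \<open>
  A finite simple undirected graph is a \<^const>\<open>pair_graph\<close>: a finite, loop-free, symmetric set of
  arcs, the undirected edge between \<open>u\<close> and \<open>v\<close> being represented by both \<open>(u, v)\<close> and \<open>(v, u)\<close>.
  Paths are the \<open>apath\<close>s of the library, i.e. arc lists that visit no vertex twice.
\<close>

definition trivial_graph :: "'a pair_pre_digraph \<Rightarrow> bool" where
  "trivial_graph G \<longleftrightarrow> card (pverts G) \<le> 1"

abbreviation path_in :: "'a pair_pre_digraph \<Rightarrow> 'a \<Rightarrow> ('a \<times> 'a) list \<Rightarrow> 'a \<Rightarrow> bool" where
  "path_in G \<equiv> pre_digraph.apath (with_proj G)"

text \<open>
  The next three notions are meant for connected graphs only (which are non-empty by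
  \<^const>\<open>connected\<close>); elsewhere \<open>LEAST\<close>, \<^const>\<open>Max\<close> and \<^const>\<open>Min\<close> may be unspecified.
\<close>

definition distance :: "'a pair_pre_digraph \<Rightarrow> 'a \<Rightarrow> 'a \<Rightarrow> nat" where
  "distance G u v = (LEAST n. \<exists>p. path_in G u p v \<and> length p = n)"

definition eccentricity :: "'a pair_pre_digraph \<Rightarrow> 'a \<Rightarrow> nat" where
  "eccentricity G v = Max {distance G v u | u. u \<in> pverts G}"

definition radius :: "'a pair_pre_digraph \<Rightarrow> nat" where
  "radius G = Min {eccentricity G v | v. v \<in> pverts G}"

definition edge_of :: "'a \<times> 'a \<Rightarrow> 'a set" where
  "edge_of a = {fst a, snd a}"

definition edges :: "'a pair_pre_digraph \<Rightarrow> 'a set set" where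
  "edges G = edge_of ` parcs G"

text \<open>
  Colors are natural numbers, which suffices for finite graphs. An edge coloring is a function on
  undirected edges, so the two orientations of an edge have the same color by construction; only
  its values on \<open>edges G\<close> matter.
\<close>

definition rainbow_path ::
  "'a pair_pre_digraph \<Rightarrow> ('a set \<Rightarrow> nat) \<Rightarrow> 'a \<Rightarrow> ('a \<times> 'a) list \<Rightarrow> 'a \<Rightarrow> bool" where
  "rainbow_path G c u p v \<longleftrightarrow> path_in G u p v \<and> distinct (map (\<lambda>a. c (edge_of a)) p)"

definition rainbow_coloring :: "'a pair_pre_digraph \<Rightarrow> ('a set \<Rightarrow> nat) \<Rightarrow> bool" where
  "rainbow_coloring G c \<longleftrightarrow>
     (\<forall>u \<in> pverts G. \<forall>v \<in> pverts G. \<exists>p. rainbow_path G c u p v)"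

text \<open>
  For a finite connected graph the minimum is over a non-empty set: an injective coloring is a
  rainbow coloring.
\<close>

definition rainbow_connection_number :: "'a pair_pre_digraph \<Rightarrow> nat" where
  "rainbow_connection_number G =
     (LEAST k. \<exists>c. rainbow_coloring G c \<and> card (c ` edges G) = k)"

definition lex_product ::
  "'a pair_pre_digraph \<Rightarrow> 'b pair_pre_digraph \<Rightarrow> ('a \<times> 'b) pair_pre_digraph"
  (infixl \<open>\<circ>\<^sub>L\<close> 70) where
  "G \<circ>\<^sub>L H = \<lparr>
     pverts = pverts G \<times> pverts H,
     parcs = {((g1, h1), (g2, h2)) | g1 h1 g2 h2.
       (g1, h1) \<in> pverts G \<times> pverts H \<and> (g2, h2) \<in> pverts G \<times> pverts H \<and>
       (g1, h1) \<noteq> (g2, h2) \<and>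
       ((g1, g2) \<in> parcs G \<or> g1 = g2 \<and> (h1, h2) \<in> parcs H)} \<rparr>"

definition admissible_factors :: "'a pair_pre_digraph \<Rightarrow> 'b pair_pre_digraph \<Rightarrow> bool" where
  "admissible_factors G H \<longleftrightarrow>
     pair_graph G \<and> pair_graph H \<and> \<not> trivial_graph G \<and> \<not> trivial_graph H \<and>
     connected (with_proj G)"

end

theory Submission
  imports Defs
begin

text \<open>
  Take a center of the product, let \<open>g0\<close> be its first coordinate, and layer \<open>G\<close> by distance from
  \<open>g0\<close>. Splitting \<open>H\<close> into two non-empty sides, say \<open>{h0}\<close> and the rest, and coloring an edge
  between consecutive layers by its layer and by the side of one of its ends gives every vertex
  far from \<open>g0\<close> two paths to the fiber over \<open>g0\<close> with disjoint palettes, one for each side. Hence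
  two vertices are joined through that fiber; only pairs within distance one of it need short detours,
  which use the first four colors. If the product has a universal vertex \<open>z\<close>, the remaining vertices
  contain a spanning complete bipartite graph, and three colors suffice.

  The lower bound holds since a rainbow path has at least as many colors as the distance of its
  ends. For sharpness, \<open>P\<^sub>5 \<circ> K\<^sub>2\<close> has radius 2 and diameter 4, and in \<open>K\<^sub>1\<^sub>,\<^sub>5 \<circ> K\<^sub>2\<close> two
  colors fail by the pigeonhole principle.
\<close>

section \<open>Distances and rainbow colorings\<close>

text \<open>Cutting out cycles only deletes arcs, so the length does not grow and distinct values of
  \<open>f\<close> stay distinct. Length serves distances; \<open>f\<close> as the color of an arc
  serves rainbow paths.\<close>

lemma awalk_imp_apath_preserving_distinct:
  assumes "wf_digraph G" and "pre_digraph.awalk G u p v"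
  shows "\<exists>q. pre_digraph.apath G u q v \<and> length q \<le> length p \<and>
    (distinct (map f p) \<longrightarrow> distinct (map f q))"
proof -
  interpret wf_digraph G by fact
  from assms(2) show ?thesis
  proof (induction p rule: awalk_to_apath_induct)
    case (path p)
    then show ?case by (auto simp: apath_def)
  next
    case (decomp p q r s)
    then have "p = q @ r @ s"
      by (metis awalk_cyc_decompE)
    with decomp.IH show ?case by fastforce
  qed
qed

lemma rainbow_path_if_awalk:
  assumes "pair_wf_digraph G" and "pre_digraph.awalk (with_proj G) u p v"
    and "distinct (map (\<lambda>a. c (edge_of a)) p)"
  shows "\<exists>q. rainbow_path G c u q v"
  using awalk_imp_apath_preserving_distinct[OF _ assms(2), of "\<lambda>a. c (edge_of a)"] assms
  by (auto simp: rainbow_path_def wf_digraph_wp_iff)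

lemma distance_le_if_awalk:
  assumes "pair_wf_digraph G" and "pre_digraph.awalk (with_proj G) u p v"
  shows "distance G u v \<le> length p"
proof -
  obtain q where "path_in G u q v" "length q \<le> length p"
    using awalk_imp_apath_preserving_distinct[OF _ assms(2)] assms(1)
    by (auto simp: wf_digraph_wp_iff)
  then show ?thesis
    unfolding distance_def by (blast intro: le_trans[OF Least_le])
qed

lemma distance_attained:
  assumes "path_in G u p v"
  obtains q where "path_in G u q v" and "length q = distance G u v"
  using LeastI_ex[of "\<lambda>n. \<exists>p. path_in G u p v \<and> length p = n"] assms
  unfolding distance_def by blast

text \<open>A potential that changes by at most one along each arc changes by at most the length of
  a walk. It supplies the lower bounds on distances in the example; the values are integers because
  natural subtraction truncates.\<close>

lemma le_distance_if_lipschitz: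
  fixes f :: "'a \<Rightarrow> int"
  assumes "pair_wf_digraph G" and "path_in G u p v"
    and "\<And>x y. (x, y) \<in> parcs G \<Longrightarrow> \<bar>f x - f y\<bar> \<le> 1"
  shows "\<bar>f u - f v\<bar> \<le> int (distance G u v)"
proof -
  interpret pair_wf_digraph G by fact
  have "\<bar>f u - f v\<bar> \<le> int (length q)" if "awalk u q v" for q
    using that
  proof (induction q arbitrary: u)
    case Nil
    then show ?case by (simp add: awalk_Nil_iff)
  next
    case (Cons e q)
    then have "\<bar>f u - f (snd e)\<bar> \<le> 1" "\<bar>f (snd e) - f v\<bar> \<le> int (length q)"
      using assms(3)[of u "snd e"] by (auto simp: awalk_Cons_iff)
    then show ?case by simp
  qed
  then show ?thesis
    using distance_attained[OF assms(2)] by (metis awalkI_apath)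
qed

lemma connected_apath:
  assumes "pair_graph G" and "connected (with_proj G)" and "u \<in> pverts G" and "v \<in> pverts G"
  shows "\<exists>p. path_in G u p v"
proof -
  interpret pair_graph G by fact
  show ?thesis
    using assms(2-4) reachable_mk_symmetric_eq[OF sym_arcs]
    by (auto simp: connected_def strongly_connected_def reachable_apath)
qed

lemma connected_if_reachable_from:
  assumes "pair_graph G" and "z \<in> pverts G"
    and "\<And>v. v \<in> pverts G \<Longrightarrow> \<exists>p. pre_digraph.awalk (with_proj G) z p v"
  shows "connected (with_proj G)"
proof -
  interpret pair_graph G by fact
  have "reachable (with_proj G) z v" if "v \<in> pverts G" for v
    using assms(3)[OF that] by (simp add: reachable_awalk)
  then have "reachable (with_proj G) u v" if "u \<in> pverts G" "v \<in> pverts G" for u v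
    using that symmetric_reachable[OF sym_arcs] reachable_trans by blast
  then show ?thesis
    using assms(2) reachable_mk_symmetric_eq[OF sym_arcs]
    by (auto simp: connected_def strongly_connected_def)
qed

text \<open>The vertex \<open>h\<close> is the last but one on a shortest path: its prefix bounds
  the distance to \<open>h\<close> from above, and extending a shortest path to \<open>h\<close> by
  the last arc gives the converse bound.\<close>

lemma distance_pred:
  assumes "pair_graph G" and "connected (with_proj G)" and "z \<in> pverts G" and "g \<in> pverts G"
    and "distance G z g \<noteq> 0"
  obtains h where "(h, g) \<in> parcs G" and "Suc (distance G z h) = distance G z g"
proof -
  interpret pair_graph G by fact
  obtain p where p: "path_in G z p g" "length p = distance G z g"
    using distance_attained connected_apath assms(1-4) by metis
  with assms(5) obtain q e where q: "p = q @ [e]"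
    by (metis length_0_conv rev_exhaust)
  have "awalk z (q @ [e]) g"
    using p(1) q by (simp add: apath_def)
  then have w: "awalk z q (fst e)" "e \<in> parcs G" "snd e = g"
    by (auto simp: awalk_simps)
  obtain r where r: "path_in G z r (fst e)" "length r = distance G z (fst e)"
    using distance_attained connected_apath assms(1-3) w(2) arc_fst_in_verts by metis
  have "awalk z (r @ [e]) g"
    using r(1) w(2,3) by (auto simp: apath_def awalk_simps)
  then have "distance G z g \<le> Suc (distance G z (fst e))"
    using distance_le_if_awalk[OF _ \<open>awalk z (r @ [e]) g\<close>] r(2) by (simp add: pair_wf_digraph)
  moreover have "Suc (distance G z (fst e)) \<le> distance G z g"
    using distance_le_if_awalk[OF _ w(1)] p(2) q by (simp add: pair_wf_digraph)
  ultimately show ?thesis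
    using that[of "fst e"] w(2,3) by (metis le_antisym prod.collapse)
qed

lemma distance_self:
  assumes "pair_wf_digraph G" and "z \<in> pverts G"
  shows "distance G z z = 0"
proof -
  interpret pair_wf_digraph G by fact
  show ?thesis
    using distance_le_if_awalk[OF assms(1), of z "[]" z] assms(2) by (simp add: awalk_Nil_iff)
qed

lemma distance_eq_0D:
  assumes "path_in G u p v" and "distance G u v = 0"
  shows "u = v"
  using distance_attained[OF assms(1)] assms(2)
  by (metis length_0_conv pre_digraph.apath_def pre_digraph.awalk_def pre_digraph.cas.simps(1))

lemma distance_le_1D:
  assumes "pair_wf_digraph G" and "path_in G u p v" and "distance G u v \<le> 1" and "u \<noteq> v"
  shows "(u, v) \<in> parcs G"
proof -
  interpret pair_wf_digraph G by fact
  obtain q where q: "awalk u q v" "length q \<le> 1"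
    using distance_attained[OF assms(2)] assms(3) by (metis awalkI_apath)
  with assms(4) obtain e where "q = [e]"
    by (cases q) (auto simp: awalk_Nil_iff)
  with q(1) show ?thesis
    by (cases e) (auto simp: awalk_simps)
qed

section \<open>Radius and rainbow connection number as bounds\<close>

lemma eccentricity_le_iff:
  assumes "finite (pverts G)" and "pverts G \<noteq> {}"
  shows "eccentricity G v \<le> n \<longleftrightarrow> (\<forall>u\<in>pverts G. distance G v u \<le> n)"
proof -
  have "{distance G v u | u. u \<in> pverts G} = distance G v ` pverts G" by auto
  then show ?thesis
    unfolding eccentricity_def using assms by simp
qed

lemma radius_le_iff:
  assumes "finite (pverts G)" and "pverts G \<noteq> {}"
  shows "radius G \<le> n \<longleftrightarrow> (\<exists>v\<in>pverts G. \<forall>u\<in>pverts G. distance G v u \<le> n)"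
proof -
  have "{eccentricity G v | v. v \<in> pverts G} = eccentricity G ` pverts G" by auto
  then show ?thesis
    unfolding radius_def using assms eccentricity_le_iff[OF assms]
    by (simp add: Min_le_iff)
qed

lemma finite_edges: "pair_fin_digraph G \<Longrightarrow> finite (edges G)"
  by (simp add: edges_def pair_fin_digraph.pair_finite_arcs)

lemma rainbow_path_length_le:
  assumes "pair_fin_digraph G" and "rainbow_path G c u p v"
  shows "length p \<le> card (c ` edges G)"
proof -
  have "length p = card (set (map (\<lambda>a. c (edge_of a)) p))"
    using assms(2) distinct_card by (fastforce simp: rainbow_path_def)
  also have "\<dots> \<le> card (c ` edges G)"
    using assms finite_edges[OF assms(1)]
    by (intro card_mono)
      (auto simp: rainbow_path_def edges_def pre_digraph.apath_def pre_digraph.awalk_def)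
  finally show ?thesis .
qed

lemma distance_le_card_colors:
  assumes "pair_fin_digraph G" and "rainbow_coloring G c" and "u \<in> pverts G" and "v \<in> pverts G"
  shows "distance G u v \<le> card (c ` edges G)"
proof -
  obtain p where p: "rainbow_path G c u p v"
    using assms(2-4) by (auto simp: rainbow_coloring_def)
  have "distance G u v \<le> length p"
    using p unfolding distance_def rainbow_path_def by (auto intro: Least_le)
  then show ?thesis
    using rainbow_path_length_le[OF assms(1) p] by simp
qed

lemma rainbow_connection_number_le:
  assumes "rainbow_coloring G c" and "c ` edges G \<subseteq> S" and "finite S"
  shows "rainbow_connection_number G \<le> card S"
proof -
  have "rainbow_connection_number G \<le> card (c ` edges G)"
    unfolding rainbow_connection_number_def using assms(1) by (auto intro: Least_le)
  also have "\<dots> \<le> card S"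
    using assms(2,3) by (rule card_mono[rotated])
  finally show ?thesis .
qed

text \<open>The given rainbow coloring ensures that the \<open>LEAST\<close> in the definition is
  attained, so a bound for all rainbow colorings passes to the minimum.\<close>

lemma le_rainbow_connection_number:
  assumes "rainbow_coloring G c"
    and "\<And>c. rainbow_coloring G c \<Longrightarrow> n \<le> card (c ` edges G)"
  shows "n \<le> rainbow_connection_number G"
proof -
  have "\<exists>k c. rainbow_coloring G c \<and> card (c ` edges G) = k"
    using assms(1) by blast
  from LeastI_ex[OF this] obtain c where "rainbow_coloring G c"
    and "card (c ` edges G) = rainbow_connection_number G"
    unfolding rainbow_connection_number_def by blast
  with assms(2) show ?thesis by metis
qed

lemma radius_le_rainbow_connection_number:
  assumes "pair_fin_digraph G" and "pverts G \<noteq> {}" and "rainbow_coloring G c"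
  shows "radius G \<le> rainbow_connection_number G"
  using assms(3)
proof (rule le_rainbow_connection_number)
  fix c assume "rainbow_coloring G c"
  with assms show "radius G \<le> card (c ` edges G)"
    by (auto simp: radius_le_iff pair_fin_digraph.pair_finite_verts
        intro!: distance_le_card_colors)
qed

section \<open>Colored walks\<close>

text \<open>A walk is recorded by its colors alone, so being rainbow becomes \<open>distinct\<close>
  of a mostly explicit list. Vertices may repeat, which makes concatenation unconditional.\<close>

fun colored_walk ::
  "'a pair_pre_digraph \<Rightarrow> ('a set \<Rightarrow> nat) \<Rightarrow> 'a \<Rightarrow> nat list \<Rightarrow> 'a \<Rightarrow> bool" where
  "colored_walk G c u [] v \<longleftrightarrow> u = v \<and> u \<in> pverts G"
| "colored_walk G c u (k # ks) v \<longleftrightarrow>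
     (\<exists>w. (u, w) \<in> parcs G \<and> c {u, w} = k \<and> colored_walk G c w ks v)"

lemma awalk_if_colored_walk:
  assumes "pair_wf_digraph G" and "colored_walk G c u ks v"
  shows "\<exists>p. pre_digraph.awalk (with_proj G) u p v \<and> map (\<lambda>a. c (edge_of a)) p = ks"
proof -
  interpret pair_wf_digraph G by fact
  show ?thesis
    using assms(2)
  proof (induction ks arbitrary: u)
    case Nil
    then show ?case by (auto simp: awalk_Nil_iff)
  next
    case (Cons k ks)
    then obtain w where "(u, w) \<in> parcs G" "c {u, w} = k" "colored_walk G c w ks v"
      by auto
    moreover from Cons.IH[OF this(3)] obtain p where "awalk w p v" "map (\<lambda>a. c (edge_of a)) p = ks"
      by blast
    ultimately show ?case
      by (intro exI[of _ "(u, w) # p"]) (simp add: awalk_Cons_iff edge_of_def)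
  qed
qed

lemma colored_walk_append:
  "colored_walk G c u ks v \<Longrightarrow> colored_walk G c v ls w \<Longrightarrow> colored_walk G c u (ks @ ls) w"
  by (induction ks arbitrary: u) auto

lemma colored_walk_rev:
  assumes "pair_graph G" and "colored_walk G c u ks v"
  shows "colored_walk G c v (rev ks) u"
proof -
  interpret pair_graph G by fact
  show ?thesis
    using assms(2)
  proof (induction ks arbitrary: u)
    case (Cons k ks)
    then obtain w where w: "(u, w) \<in> parcs G" "c {u, w} = k" "colored_walk G c v (rev ks) w"
      by auto
    then have "colored_walk G c w [k] u"
      by (auto simp: arcs_symmetric insert_commute wellformed')
    with w(3) show ?case
      by (simp add: colored_walk_append)
  qed simp
qed

declare colored_walk.simps(2) [simp del]

definition rainbow_linked :: "'a pair_pre_digraph \<Rightarrow> ('a set \<Rightarrow> nat) \<Rightarrow> 'a \<Rightarrow> 'a \<Rightarrow> bool" where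
  "rainbow_linked G c u v \<longleftrightarrow> (\<exists>ks. colored_walk G c u ks v \<and> distinct ks)"

lemma rainbow_linkedI: "colored_walk G c u ks v \<Longrightarrow> distinct ks \<Longrightarrow> rainbow_linked G c u v"
  by (auto simp: rainbow_linked_def)

lemma rainbow_linked_sym:
  "pair_graph G \<Longrightarrow> rainbow_linked G c u v \<Longrightarrow> rainbow_linked G c v u"
  unfolding rainbow_linked_def by (metis colored_walk_rev distinct_rev)

text \<open>Walks are enough here: a walk with distinct colors shortens to a path whose colors are
  still distinct.\<close>

lemma rainbow_coloringI:
  assumes "pair_graph G"
    and "\<And>u v. u \<in> pverts G \<Longrightarrow> v \<in> pverts G \<Longrightarrow> rainbow_linked G c u v"
  shows "rainbow_coloring G c"
proof -
  have wf: "pair_wf_digraph G"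
    using assms(1) by (simp add: pair_graph_def pair_digraph_def pair_fin_digraph_def)
  have "\<exists>p. rainbow_path G c u p v" if uv: "u \<in> pverts G" "v \<in> pverts G" for u v
  proof -
    obtain ks where ks: "colored_walk G c u ks v" "distinct ks"
      using assms(2)[OF uv] by (auto simp: rainbow_linked_def)
    show ?thesis
      using awalk_if_colored_walk[OF wf ks(1)] ks(2) rainbow_path_if_awalk[OF wf] by auto
  qed
  then show ?thesis by (simp add: rainbow_coloring_def)
qed

text \<open>
  Colors the edge \<open>{x, y}\<close> with \<open>f x < f y\<close> by \<open>col x y\<close>, so that \<open>col\<close> need not be symmetric.
\<close>

definition graded_coloring :: "('a \<Rightarrow> nat) \<Rightarrow> ('a \<Rightarrow> 'a \<Rightarrow> nat) \<Rightarrow> 'a set \<Rightarrow> nat" where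
  "graded_coloring f col e =
     (if \<exists>x y. e = {x, y} \<and> f x < f y
      then THE k. \<exists>x y. e = {x, y} \<and> f x < f y \<and> k = col x y else 0)"

text \<open>The strict inequality of grades fixes which end plays the role of \<open>x\<close>, so
  the definite description has a unique solution.\<close>

lemma graded_coloring_eq:
  assumes "f x < f y"
  shows "graded_coloring f col {x, y} = col x y" "graded_coloring f col {y, x} = col x y"
proof -
  have "(THE k. \<exists>x' y'. {x, y} = {x', y'} \<and> f x' < f y' \<and> k = col x' y') = col x y"
    using assms by (intro the_equality) (auto simp: doubleton_eq_iff)
  then show "graded_coloring f col {x, y} = col x y"
    using assms unfolding graded_coloring_def by auto
  then show "graded_coloring f col {y, x} = col x y"
    by (simp add: insert_commute)
qed

lemma graded_coloring_edge_lt: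
  assumes "e \<in> edges G" and "0 < n"
    and "\<And>x y. (x, y) \<in> parcs G \<or> (y, x) \<in> parcs G \<Longrightarrow> f x < f y \<Longrightarrow> col x y < n"
  shows "graded_coloring f col e < n"
proof -
  obtain x y where e: "e = {x, y}" "(x, y) \<in> parcs G"
    using assms(1) by (auto simp: edges_def edge_of_def)
  consider "f x < f y" | "f y < f x" | "f x = f y" by linarith
  then show ?thesis
  proof cases
    \<comment> \<open>Edges between vertices of equal grade receive the default color 0, whence the
      assumption that \<open>n\<close> is positive.\<close>
    case 3
    then have "graded_coloring f col e = 0"
      by (auto simp: graded_coloring_def e doubleton_eq_iff)
    with assms(2) show ?thesis by simp
  qed (use e assms(3) in \<open>auto simp: graded_coloring_eq\<close>)
qed

section \<open>The lexicographic product as a graph\<close>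

lemma in_pverts_lex_product [simp]:
  "(g, h) \<in> pverts (G \<circ>\<^sub>L H) \<longleftrightarrow> g \<in> pverts G \<and> h \<in> pverts H"
  by (simp add: lex_product_def)

lemma pverts_lex_product: "pverts (G \<circ>\<^sub>L H) = pverts G \<times> pverts H"
  by (simp add: lex_product_def)

lemma in_parcs_lex_product:
  "((g, h), (g', h')) \<in> parcs (G \<circ>\<^sub>L H) \<longleftrightarrow>
     g \<in> pverts G \<and> g' \<in> pverts G \<and> h \<in> pverts H \<and> h' \<in> pverts H \<and> (g, h) \<noteq> (g', h') \<and>
     ((g, g') \<in> parcs G \<or> g = g' \<and> (h, h') \<in> parcs H)"
  by (auto simp: lex_product_def)

lemma pair_graph_lex_product:
  assumes "pair_graph G" and "pair_graph H"
  shows "pair_graph (G \<circ>\<^sub>L H)"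
proof -
  interpret G: pair_graph G by fact
  interpret H: pair_graph H by fact
  have sub: "parcs (G \<circ>\<^sub>L H) \<subseteq> pverts (G \<circ>\<^sub>L H) \<times> pverts (G \<circ>\<^sub>L H)"
    by (auto simp: in_parcs_lex_product)
  have fin: "finite (pverts (G \<circ>\<^sub>L H))"
    by (simp add: pverts_lex_product G.pair_finite_verts H.pair_finite_verts)
  show ?thesis
  proof
    show "finite (parcs (G \<circ>\<^sub>L H))"
      using finite_subset[OF sub] fin by simp
    show "symmetric (with_proj (G \<circ>\<^sub>L H))"
      by (auto simp: symmetric_def sym_def in_parcs_lex_product
          intro: G.arcs_symmetric H.arcs_symmetric)
    show "finite (pverts (G \<circ>\<^sub>L H))" by (rule fin)
  qed (use sub in \<open>auto simp: in_parcs_lex_product\<close>)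
qed

section \<open>The coloring of the product by levels\<close>

text \<open>
  The function \<open>lev\<close> plays the role of the distance to the center \<open>g0\<close>.
\<close>

locale lex_levels =
  fixes G :: "'a pair_pre_digraph" and H :: "'b pair_pre_digraph"
    and lev :: "'a \<Rightarrow> nat" and R :: nat and g0 :: 'a and h0 h1 :: 'b
  assumes pair_graph_G: "pair_graph G" and pair_graph_H: "pair_graph H"
    and root: "g0 \<in> pverts G" and h0: "h0 \<in> pverts H" and h1: "h1 \<in> pverts H" and h0_neq_h1: "h0 \<noteq> h1"
    and lev_eq_0_iff: "g \<in> pverts G \<Longrightarrow> lev g = 0 \<longleftrightarrow> g = g0"
    and lev_pred: "g \<in> pverts G \<Longrightarrow> lev g \<noteq> 0 \<Longrightarrow> \<exists>g'. (g', g) \<in> parcs G \<and> Suc (lev g') = lev g"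
    and lev_le: "g \<in> pverts G \<Longrightarrow> lev g \<le> R"
    and two_le_R: "2 \<le> R"
    and nontrivial: "\<exists>g\<in>pverts G. g \<noteq> g0"
begin

sublocale G: pair_graph G by (rule pair_graph_G)

abbreviation L where "L \<equiv> G \<circ>\<^sub>L H"

definition side :: "'b \<Rightarrow> nat" where
  "side h = (if h = h0 then 0 else 1)"

definition inner :: "'a \<Rightarrow> bool" where
  "inner g \<longleftrightarrow> (\<exists>g'. (g, g') \<in> parcs G \<and> lev g' = 2)"

text \<open>
  The parity of a color encodes a side, so climbing with parity \<open>t\<close> leaves parity \<open>1 - t\<close> free for
  the other vertex. A vertex of level 1 without a neighbor in level 2 has no detour through level 2;
  its edges to the root fiber therefore use all four colors 0 to 3 instead of just 0 and 1.
\<close>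

definition down_color :: "'a \<times> 'b \<Rightarrow> 'a \<times> 'b \<Rightarrow> nat" where
  "down_color x y =
     (if lev (fst x) \<noteq> 0 then 2 * lev (fst x) + side (snd x)
      else if inner (fst y) then side (snd y)
      else 2 * side (snd x) + side (snd y))"

definition col :: "('a \<times> 'b) set \<Rightarrow> nat" where
  "col = graded_coloring (lev \<circ> fst) down_color"

abbreviation cw where "cw \<equiv> colored_walk L col"
abbreviation linked where "linked \<equiv> rainbow_linked L col"

lemma L: "pair_graph L"
  using pair_graph_G pair_graph_H by (rule pair_graph_lex_product)

lemma side_lt_2: "side h < 2"
  by (simp add: side_def)

lemma side_h0 [simp]: "side h0 = 0" and side_h1 [simp]: "side h1 = 1"
  using h0_neq_h1 by (simp_all add: side_def)

lemma obtain_side: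
  assumes "t < 2"
  obtains h where "h \<in> pverts H" and "side h = t"
  using assms h0 h1 h0_neq_h1 by (metis less_2_cases side_def One_nat_def)

text \<open>The end nearer to the root has level at most \<open>R - 1\<close>, so colors of the form
  \<open>2 * lev + side\<close> stay below \<open>2 * R\<close>. The root edges use colors up to 3,
  which fit since \<open>R\<close> is at least 2.\<close>

lemma col_lt:
  assumes "e \<in> edges L"
  shows "col e < 2 * R"
  unfolding col_def
proof (rule graded_coloring_edge_lt[OF assms])
  show "0 < 2 * R" using two_le_R by simp
  fix x y assume "(x, y) \<in> parcs L \<or> (y, x) \<in> parcs L" and lt: "(lev \<circ> fst) x < (lev \<circ> fst) y"
  then have "fst y \<in> pverts G"
    by (cases x; cases y) (auto simp: in_parcs_lex_product)
  with lt have "lev (fst x) < R"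
    using lev_le by fastforce
  then show "down_color x y < 2 * R"
    using side_lt_2[of "snd x"] side_lt_2[of "snd y"] two_le_R by (auto simp: down_color_def)
qed

text \<open>The root is pictured on top: \<open>up\<close> decreases the level and
  \<open>down\<close> increases it. Both rules prepend one edge to a known walk, so walks are
  assembled from their far end.\<close>

lemma cw_up:
  assumes "(g', g) \<in> parcs G" and "lev g' < lev g" and "h \<in> pverts H" and "h' \<in> pverts H"
    and "cw (g', h') ks v"
  shows "cw (g, h) (down_color (g', h') (g, h) # ks) v"
proof -
  have "((g, h), (g', h')) \<in> parcs L"
    using assms(1-4) by (auto simp: in_parcs_lex_product G.arcs_symmetric G.wellformed')
  then show ?thesis
    using assms(2,5) unfolding col_def colored_walk.simps
    by (intro exI[of _ "(g', h')"]) (simp add: graded_coloring_eq)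
qed

lemma cw_down:
  assumes "(g, g') \<in> parcs G" and "lev g < lev g'" and "h \<in> pverts H" and "h' \<in> pverts H"
    and "cw (g', h') ks v"
  shows "cw (g, h) (down_color (g, h) (g', h') # ks) v"
proof -
  have "((g, h), (g', h')) \<in> parcs L"
    using assms(1-4) by (auto simp: in_parcs_lex_product G.wellformed')
  then show ?thesis
    using assms(2,5) unfolding col_def colored_walk.simps
    by (intro exI[of _ "(g', h')"]) (simp add: graded_coloring_eq)
qed

lemma root_arc:
  assumes "g \<in> pverts G" and "lev g = 1"
  shows "(g0, g) \<in> parcs G"
proof -
  obtain g' where g': "(g', g) \<in> parcs G" "Suc (lev g') = lev g"
    using lev_pred[OF assms(1)] assms(2) by auto
  then have "g' = g0"
    using lev_eq_0_iff[of g'] assms(2) by (simp add: G.wellformed')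
  with g'(1) show ?thesis by simp
qed

lemma lev_root [simp]: "lev g0 = 0"
  using lev_eq_0_iff root by simp

text \<open>For inner \<open>g\<close> the color ignores \<open>x\<close>, so one color reaches the
  whole root fiber; otherwise the side of \<open>x\<close> selects between the colors 0, 1 and the
  colors 2, 3.\<close>

lemma cw_to_root:
  assumes "g \<in> pverts G" and "lev g = 1" and "h \<in> pverts H" and "x \<in> pverts H"
    and "cw (g0, x) ks v"
  shows "cw (g, h) ((if inner g then side h else 2 * side x + side h) # ks) v"
  using cw_up[OF root_arc[OF assms(1,2)] _ assms(3-5)] assms(2)
  by (simp add: down_color_def split: if_splits)

lemma cw_from_root:
  assumes "g \<in> pverts G" and "lev g = 1" and "h \<in> pverts H" and "x \<in> pverts H"
    and "cw (g, h) ks v"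
  shows "cw (g0, x) ((if inner g then side h else 2 * side x + side h) # ks) v"
  using cw_down[OF root_arc[OF assms(1,2)] _ assms(4,3,5)] assms(2)
  by (simp add: down_color_def split: if_splits)

lemma cw_Nil: "g \<in> pverts G \<Longrightarrow> h \<in> pverts H \<Longrightarrow> cw (g, h) [] (g, h)"
  by simp

text \<open>Each upward step enters the next lower level at a vertex of side \<open>t\<close>, which
  gives its color parity \<open>t\<close>. The bound by \<open>2 * lev g\<close> keeps the color of
  a new first edge apart from those of the remaining walk.\<close>

lemma far_to_root:
  assumes "g \<in> pverts G" and "2 \<le> lev g" and "h \<in> pverts H" and "x \<in> pverts H" and "t < 2"
  shows "\<exists>ks. cw (g, h) ks (g0, x) \<and> distinct ks \<and> (\<forall>k\<in>set ks. k mod 2 = t \<and> k < 2 * lev g)"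
  using assms(1-3)
proof (induction "lev g" arbitrary: g h rule: less_induct)
  case less
  obtain g' where g': "(g', g) \<in> parcs G" "Suc (lev g') = lev g"
    using lev_pred[OF less.prems(1)] less.prems(2) by auto
  then have g'V: "g' \<in> pverts G" by (simp add: G.wellformed')
  obtain y where y: "y \<in> pverts H" "side y = t"
    using obtain_side[OF assms(5)] .
  have c: "down_color (g', y) (g, h) = 2 * lev g' + t"
    using g'(2) less.prems(2) y(2) by (simp add: down_color_def)
  show ?case
  proof (cases "2 \<le> lev g'")
    case True
    then obtain ks where ks: "cw (g', y) ks (g0, x)" "distinct ks"
      "\<forall>k\<in>set ks. k mod 2 = t \<and> k < 2 * lev g'"
      using less.hyps[of g' y] g' g'V y(1) by auto
    have "cw (g, h) ((2 * lev g' + t) # ks) (g0, x)"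
      using cw_up[OF g'(1) _ less.prems(3) y(1) ks(1)] g'(2) c by simp
    then show ?thesis
      using ks(2,3) g'(2) assms(5) by (intro exI[of _ "(2 * lev g' + t) # ks"]) auto
  next
    case False
    then have l: "lev g' = 1" "lev g = 2" using g'(2) less.prems(2) by auto
    \<comment> \<open>The level-1 vertex is adjacent to \<open>g\<close> in level 2, hence inner, so
      the last edge has color \<open>t\<close> for any target \<open>x\<close>.\<close>
    then have "inner g'" using g'(1) by (auto simp: inner_def)
    then have "cw (g', y) [t] (g0, x)"
      using cw_to_root[OF g'V l(1) y(1) assms(4) cw_Nil] root assms(4) y(2) by simp
    then have "cw (g, h) [2 + t, t] (g0, x)"
      using cw_up[OF g'(1) _ less.prems(3) y(1)] l c by simp
    then show ?thesis
      using l assms(5) by (intro exI[of _ "[2 + t, t]"]) auto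
  qed
qed

lemma obtain_far_to_root:
  assumes "g \<in> pverts G" and "2 \<le> lev g" and "h \<in> pverts H" and "x \<in> pverts H" and "t < 2"
  obtains ks where "cw (g, h) ks (g0, x)" and "distinct ks" and "\<forall>k\<in>set ks. k mod 2 = t"
  using far_to_root[OF assms] by blast

text \<open>Aiming at \<open>h0\<close>, whose side is 0, makes the inner and the other case of the
  root edge color agree.\<close>

lemma near_to_root:
  assumes "g \<in> pverts G" and "lev g = 1" and "h \<in> pverts H"
  shows "cw (g, h) [side h] (g0, h0)"
  using cw_to_root[OF assms h0 cw_Nil[OF root h0]] by (cases "inner g") simp_all

lemma linked_via_root:
  assumes "cw u ks z" and "cw v ls z" and "distinct ks" and "distinct ls"
    and "set ks \<inter> set ls = {}"
  shows "linked u v"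
  using colored_walk_append[OF assms(1) colored_walk_rev[OF L assms(2)]] assms(3-5)
  by (auto simp: rainbow_linked_def)

text \<open>The two ends get opposite parities. A vertex of level 1 reaches \<open>(g0, h0)\<close>
  by the single color \<open>side h'\<close>, so the far vertex climbs with parity
  \<open>1 - side h'\<close>; two far vertices take parities 0 and 1. A vertex over the root is
  itself the target of the climb.\<close>

lemma linked_far:
  assumes "g \<in> pverts G" and "2 \<le> lev g" and "h \<in> pverts H"
    and "g' \<in> pverts G" and "h' \<in> pverts H"
  shows "linked (g, h) (g', h')"
proof -
  consider "lev g' = 0" | "lev g' = 1" | "2 \<le> lev g'" by linarith
  then show ?thesis
  proof cases
    case 1
    then have "g' = g0" using lev_eq_0_iff assms(4) by simp
    then show ?thesis
      by (metis obtain_far_to_root[OF assms(1-3,5)] rainbow_linkedI zero_less_numeral)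
  next
    case 2
    have "1 - side h' < 2" by simp
    from obtain_far_to_root[OF assms(1-3) h0 this] obtain ks where ks: "cw (g, h) ks (g0, h0)" "distinct ks"
      "\<forall>k\<in>set ks. k mod 2 = 1 - side h'"
      by blast
    have "side h' mod 2 \<noteq> 1 - side h'" by (simp add: side_def)
    with ks(3) have "side h' \<notin> set ks" by blast
    then show ?thesis
      using linked_via_root[OF ks(1) near_to_root[OF assms(4) 2 assms(5)] ks(2)] by simp
  next
    case 3
    obtain ks where ks: "cw (g, h) ks (g0, h0)" "distinct ks" "\<forall>k\<in>set ks. k mod 2 = 0"
      using obtain_far_to_root[OF assms(1-3) h0, of 0] by (metis zero_less_numeral)
    obtain ls where ls: "cw (g', h') ls (g0, h0)" "distinct ls" "\<forall>k\<in>set ls. k mod 2 = 1"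
      using obtain_far_to_root[OF assms(4) 3 assms(5) h0, of 1] by (metis one_less_numeral_iff semiring_norm(76))
    have "set ks \<inter> set ls = {}"
      using ks(3) ls(3) by (metis disjoint_iff zero_neq_one)
    then show ?thesis
      using linked_via_root ks(1,2) ls(1,2) by blast
  qed
qed

text \<open>This changes sides within the fiber of an inner vertex by going through level 2. The
  colors lie in 2, 3 and so avoid the colors 0, 1 of the root edges at inner vertices.\<close>

lemma detour:
  assumes "g \<in> pverts G" and "lev g = 1" and "inner g"
    and "h \<in> pverts H" and "h' \<in> pverts H" and "cw (g, h') ks v"
  shows "cw (g, h) ((2 + side h) # (2 + side h') # ks) v"
proof -
  obtain g' where g': "(g, g') \<in> parcs G" "lev g' = 2"
    using assms(3) by (auto simp: inner_def)
  have "cw (g', h0) ((2 + side h') # ks) v"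
    using cw_up[OF g'(1) _ h0 assms(5,6)] g'(2) assms(2) by (simp add: down_color_def)
  then show ?thesis
    using cw_down[OF g'(1) _ assms(4) h0] g'(2) assms(2) by (simp add: down_color_def)
qed

lemma obtain_other_side:
  obtains h' where "h' \<in> pverts H" and "side h' = 1 - side h"
  by (rule obtain_side[of "1 - side h"]) auto

text \<open>On opposite sides the edges to \<open>(g0, h0)\<close> have different colors. On equal
  sides these colors clash, so the walk takes a detour through level 2, or passes
  \<open>(g0, h1)\<close>, where vertices that are not inner attach with colors 2 and 3.\<close>

lemma linked_near:
  assumes "g \<in> pverts G" and "lev g = 1" and "h \<in> pverts H"
    and "g' \<in> pverts G" and "lev g' = 1" and "h' \<in> pverts H"
  shows "linked (g, h) (g', h')"
proof (cases "side h = side h'")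
  case False
  then show ?thesis
    using linked_via_root[OF near_to_root[OF assms(1-3)] near_to_root[OF assms(4-6)]] by simp
next
  case True
  obtain y where y: "y \<in> pverts H" "side y = 1 - side h"
    using obtain_other_side .
  have s: "side h = 0 \<or> side h = 1" by (simp add: side_def)
  note nil = cw_Nil[OF assms(4,6)] and nil' = cw_Nil[OF assms(1,3)]
  have *: ?thesis if "inner g"
  proof (cases "inner g'")
    case True': True
    \<comment> \<open>The detour leads to \<open>(g, y)\<close> on the other side, from where the
      two root edges have different colors.\<close>
    have "cw (g, h) [2 + side h, 2 + side y, side y, side h'] (g', h')"
      using cw_from_root[OF assms(4-6) h0 nil] cw_to_root[OF assms(1,2) y(1) h0]
        detour[OF assms(1,2) that assms(3) y(1)] that True' by simp
    then show ?thesis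
      using True y(2) s by (intro rainbow_linkedI) auto
  next
    case False
    have "cw (g, h) [side h, 2 + side h'] (g', h')"
      using cw_from_root[OF assms(4-6) h1 nil] cw_to_root[OF assms(1-3) h1]
        that False by simp
    then show ?thesis
      using True s by (intro rainbow_linkedI) auto
  qed
  consider "inner g" | "\<not> inner g" "inner g'" | "\<not> inner g" "\<not> inner g'" by blast
  then show ?thesis
  proof cases
    case 2
    have "cw (g', h') [side h', 2 + side h] (g, h)"
      using cw_from_root[OF assms(1-3) h1 nil'] cw_to_root[OF assms(4-6) h1]
        2 by simp
    then show ?thesis
      using True s by (intro rainbow_linked_sym[OF L, OF rainbow_linkedI]) auto
  next
    case 3
    \<comment> \<open>The walk visits the root fiber twice: up to \<open>(g0, h0)\<close>, down to
      \<open>(g, y)\<close>, up to \<open>(g0, h1)\<close>, down to \<open>(g', h')\<close>.\<close>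
    have "cw (g, h) [side h, side y, 2 + side y, 2 + side h'] (g', h')"
      using cw_from_root[OF assms(4-6) h1 nil] cw_to_root[OF assms(1,2) y(1) h1]
        cw_from_root[OF assms(1,2) y(1) h0] cw_to_root[OF assms(1-3) h0] 3 by simp
    then show ?thesis
      using True y(2) s by (intro rainbow_linkedI) auto
  qed (rule *)
qed

lemma ex_near: "\<exists>g\<in>pverts G. lev g = 1"
proof -
  have "\<exists>g'\<in>pverts G. lev g' = 1" if "g \<in> pverts G" "lev g = Suc n" for g n
    using that
  proof (induction n arbitrary: g)
    case (Suc n)
    then obtain g' where "(g', g) \<in> parcs G" "lev g' = Suc n"
      using lev_pred[of g] by auto
    then show ?case using Suc.IH[of g'] by (simp add: G.wellformed')
  qed auto
  moreover obtain g where "g \<in> pverts G" "g \<noteq> g0"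
    using nontrivial by blast
  ultimately show ?thesis
    using lev_eq_0_iff[of g] by (metis not0_implies_Suc)
qed

text \<open>The walk leaves the root fiber and returns through one level-1 vertex \<open>g\<close>,
  found by descending from any non-root vertex. Equal ends need no special treatment, as closed
  walks are allowed.\<close>

lemma linked_root:
  assumes "x \<in> pverts H" and "y \<in> pverts H"
  shows "linked (g0, x) (g0, y)"
proof -
  obtain g where g: "g \<in> pverts G" "lev g = 1"
    using ex_near by blast
  obtain w where w: "w \<in> pverts H" "side w = 1 - side x"
    using obtain_other_side .
  have s: "side x = 0 \<or> side x = 1" "side y = 0 \<or> side y = 1" by (simp_all add: side_def)
  note nil = cw_Nil[OF root assms(2)]
  consider "inner g" | "\<not> inner g" "side x = side y" | "\<not> inner g" "side x \<noteq> side y" by blast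
  then show ?thesis
  proof cases
    case 1
    \<comment> \<open>Down to \<open>(g, h0)\<close>, by the detour to \<open>(g, h1)\<close>, and
      back up.\<close>
    have "cw (g0, x) [0, 2, 3, 1] (g0, y)"
      using cw_to_root[OF g h1 assms(2) nil] detour[OF g 1 h0 h1]
        cw_from_root[OF g h0 assms(1)] 1 by simp
    then show ?thesis by (rule rainbow_linkedI) simp
  next
    case 2
    \<comment> \<open>A zigzag through \<open>(g, h0)\<close>, \<open>(g0, w)\<close> and
      \<open>(g, h1)\<close>, with \<open>w\<close> on the side opposite to \<open>x\<close> and
      \<open>y\<close>, uses each of the four colors once.\<close>
    have "cw (g0, x) [2 * side x, 2 * side w, 2 * side w + 1, 2 * side y + 1] (g0, y)"
      using cw_to_root[OF g h1 assms(2) nil] cw_from_root[OF g h1 w(1)]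
        cw_to_root[OF g h0 w(1)] cw_from_root[OF g h0 assms(1)] 2 by simp
    then show ?thesis
      using s w(2) 2 by (intro rainbow_linkedI) auto
  next
    case 3
    have "cw (g0, x) [2 * side x, 2 * side y] (g0, y)"
      using cw_to_root[OF g h0 assms(2) nil] cw_from_root[OF g h0 assms(1)] 3 by simp
    then show ?thesis
      using s 3 by (intro rainbow_linkedI) auto
  qed
qed

lemma linked_root_near:
  assumes "g \<in> pverts G" and "lev g = 1" and "h \<in> pverts H" and "x \<in> pverts H"
  shows "linked (g0, x) (g, h)"
  by (rule rainbow_linkedI[OF cw_from_root[OF assms cw_Nil[OF assms(1,3)]]]) simp

lemma rainbow_coloring_col: "rainbow_coloring L col"
proof (rule rainbow_coloringI[OF L])
  fix u v assume "u \<in> pverts L" "v \<in> pverts L"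
  then obtain g h g' h' where uv: "u = (g, h)" "v = (g', h')"
    and V: "g \<in> pverts G" "h \<in> pverts H" "g' \<in> pverts G" "h' \<in> pverts H"
    by (cases u; cases v) auto
  have eq: "k = g0" if "k \<in> pverts G" "lev k = 0" for k
    using that lev_eq_0_iff by simp
  consider "2 \<le> lev g" | "2 \<le> lev g'" | "lev g = 1" "lev g' = 1" | "lev g = 0" "lev g' = 0"
    | "lev g = 0" "lev g' = 1" | "lev g = 1" "lev g' = 0"
    by linarith
  then show "linked u v"
    unfolding uv
  proof cases
    case 1
    then show "linked (g, h) (g', h')" using V by (intro linked_far)
  next
    case 2
    then show "linked (g, h) (g', h')" using V by (intro rainbow_linked_sym[OF L, OF linked_far])
  next
    case 3
    then show "linked (g, h) (g', h')" using V by (intro linked_near)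
  next
    case 4
    then show "linked (g, h) (g', h')" using V eq[of g] eq[of g'] by (simp add: linked_root)
  next
    case 5
    then show "linked (g, h) (g', h')" using V eq[of g] by (simp add: linked_root_near)
  next
    case 6
    then show "linked (g, h) (g', h')"
      using V eq[of g'] by (simp add: rainbow_linked_sym[OF L, OF linked_root_near])
  qed
qed

lemma rainbow_connection_number_le_2R: "rainbow_connection_number L \<le> 2 * R"
  using rainbow_connection_number_le[OF rainbow_coloring_col, of "{..<2 * R}"] col_lt by auto

end

section \<open>Upper bounds\<close>

lemma admissible_factorsD:
  assumes "admissible_factors G H"
  shows "pair_graph G" and "pair_graph H" and "pair_graph (G \<circ>\<^sub>L H)" and "connected (with_proj G)"
    and "pverts (G \<circ>\<^sub>L H) \<noteq> {}" and "pair_fin_digraph (G \<circ>\<^sub>L H)" and "pair_wf_digraph (G \<circ>\<^sub>L H)"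
proof -
  show G: "pair_graph G" and H: "pair_graph H" and "connected (with_proj G)"
    using assms by (auto simp: admissible_factors_def)
  show L: "pair_graph (G \<circ>\<^sub>L H)"
    using G H by (rule pair_graph_lex_product)
  show "pverts (G \<circ>\<^sub>L H) \<noteq> {}"
    using assms by (auto simp: admissible_factors_def trivial_graph_def pverts_lex_product)
  interpret pair_graph "G \<circ>\<^sub>L H" by (rule L)
  show "pair_fin_digraph (G \<circ>\<^sub>L H)" ..
  show "pair_wf_digraph (G \<circ>\<^sub>L H)" ..
qed

lemma nontrivial_ex_other:
  assumes "\<not> trivial_graph G" and "finite (pverts G)"
  shows "\<exists>w\<in>pverts G. w \<noteq> v"
proof (rule ccontr)
  assume "\<not> ?thesis"
  then have "pverts G \<subseteq> {v}" by auto
  then have "card (pverts G) \<le> card {v}" by (intro card_mono) auto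
  with assms(1) show False by (simp add: trivial_graph_def)
qed

lemma lex_levels_distance:
  assumes "admissible_factors G H" and "z \<in> pverts G" and "2 \<le> R"
    and "\<And>g. g \<in> pverts G \<Longrightarrow> distance G z g \<le> R"
  shows "\<exists>h0 h1. lex_levels G H (distance G z) R z h0 h1"
proof -
  interpret G: pair_graph G using admissible_factorsD(1)[OF assms(1)] .
  interpret H: pair_graph H using admissible_factorsD(2)[OF assms(1)] .
  have G: "\<not> trivial_graph G" and H: "\<not> trivial_graph H" and conn: "connected (with_proj G)"
    using assms(1) by (auto simp: admissible_factors_def)
  obtain h0 where h0: "h0 \<in> pverts H"
    using nontrivial_ex_other[OF H H.pair_finite_verts] by blast
  obtain h1 where h1: "h1 \<in> pverts H" "h1 \<noteq> h0"
    using nontrivial_ex_other[OF H H.pair_finite_verts] by blast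
  have "lex_levels G H (distance G z) R z h0 h1"
  proof
    fix g assume g: "g \<in> pverts G"
    obtain p where "path_in G z p g"
      using connected_apath[OF G.pair_graph conn assms(2) g] by blast
    then show "distance G z g = 0 \<longleftrightarrow> g = z"
      using distance_eq_0D distance_self[OF G.pair_wf_digraph assms(2)] by metis
    show "\<exists>g'. (g', g) \<in> parcs G \<and> Suc (distance G z g') = distance G z g"
      if "distance G z g \<noteq> 0"
      using distance_pred[OF G.pair_graph conn assms(2) g that] by blast
  qed (use assms h0 h1 nontrivial_ex_other[OF G G.pair_finite_verts] in auto)
  then show ?thesis by blast
qed

text \<open>Only existence matters, so any root works, with \<open>R\<close> large enough for all
  levels and for the four colors near the root.\<close>

lemma ex_rainbow_coloring:
  assumes "admissible_factors G H"
  shows "\<exists>c. rainbow_coloring (G \<circ>\<^sub>L H) c"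
proof -
  interpret G: pair_graph G using admissible_factorsD(1)[OF assms] .
  obtain z where z: "z \<in> pverts G"
    using nontrivial_ex_other G.pair_finite_verts assms by (metis admissible_factors_def)
  define R where "R = max 2 (Max (distance G z ` pverts G))"
  have "distance G z g \<le> R" if "g \<in> pverts G" for g
    using that by (simp add: R_def le_max_iff_disj)
  then obtain h0 h1 where "lex_levels G H (distance G z) R z h0 h1"
    using lex_levels_distance[OF assms z, of R] by (auto simp: R_def)
  then show ?thesis
    by (intro exI) (rule lex_levels.rainbow_coloring_col)
qed

text \<open>Connectedness of the product is read off from a rainbow coloring, which already joins
  any two vertices by a path.\<close>

lemma lex_product_path:
  assumes "admissible_factors G H" and "u \<in> pverts (G \<circ>\<^sub>L H)" and "v \<in> pverts (G \<circ>\<^sub>L H)"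
  shows "\<exists>p. path_in (G \<circ>\<^sub>L H) u p v"
  using ex_rainbow_coloring[OF assms(1)] assms(2,3)
  unfolding rainbow_coloring_def rainbow_path_def by blast

text \<open>Projecting a walk to the first coordinate and dropping the edges inside a fiber gives a
  walk that is no longer.\<close>

lemma distance_fst_le:
  assumes "pair_graph G" and "pair_graph H" and "path_in (G \<circ>\<^sub>L H) u p v"
  shows "distance G (fst u) (fst v) \<le> distance (G \<circ>\<^sub>L H) u v"
proof -
  interpret G: pair_graph G by fact
  interpret L: pair_graph "G \<circ>\<^sub>L H"
    using assms(1,2) by (rule pair_graph_lex_product)
  have "\<exists>q. G.awalk (fst u) q (fst v) \<and> length q \<le> length p" if "L.awalk u p v" for p
    using that
  proof (induction p arbitrary: u)
    case Nil
    then show ?case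
      by (intro exI[of _ "[]"]) (auto simp: L.awalk_Nil_iff G.awalk_Nil_iff pverts_lex_product)
  next
    case (Cons e p)
    then have e: "e \<in> parcs (G \<circ>\<^sub>L H)" "fst e = u" and "L.awalk (snd e) p v"
      by (auto simp: L.awalk_Cons_iff)
    with Cons.IH obtain q where q: "G.awalk (fst (snd e)) q (fst v)" "length q \<le> length p"
      by blast
    show ?case
    proof (cases "fst u = fst (snd e)")
      case True
      with q show ?thesis by (intro exI[of _ q]) simp
    next
      case False
      then have "(fst u, fst (snd e)) \<in> parcs G"
        using e by (cases e) (auto simp: lex_product_def)
      with q show ?thesis
        by (intro exI[of _ "(fst u, fst (snd e)) # q"]) (simp add: G.awalk_Cons_iff)
    qed
  qed
  moreover obtain q where "path_in (G \<circ>\<^sub>L H) u q v" "length q = distance (G \<circ>\<^sub>L H) u v"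
    using distance_attained[OF assms(3)] .
  ultimately obtain r where "G.awalk (fst u) r (fst v)" "length r \<le> distance (G \<circ>\<^sub>L H) u v"
    by (metis L.awalkI_apath)
  then show ?thesis
    using distance_le_if_awalk[OF G.pair_wf_digraph] le_trans by blast
qed

lemma rainbow_connection_number_lex_product_le:
  assumes "admissible_factors G H" and "radius (G \<circ>\<^sub>L H) \<le> R" and "2 \<le> R"
  shows "rainbow_connection_number (G \<circ>\<^sub>L H) \<le> 2 * R"
proof -
  note D = admissible_factorsD[OF assms(1)]
  obtain z where z: "z \<in> pverts (G \<circ>\<^sub>L H)" "\<forall>u\<in>pverts (G \<circ>\<^sub>L H). distance (G \<circ>\<^sub>L H) z u \<le> R"
    using assms(2) D(5,6) by (auto simp: radius_le_iff pair_fin_digraph.pair_finite_verts)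
  \<comment> \<open>A center of the product projects to a root with all levels at most
    \<open>R\<close>: lift \<open>g\<close> to the second coordinate of \<open>z\<close> and project
    the distance.\<close>
  have "distance G (fst z) g \<le> R" if "g \<in> pverts G" for g
  proof -
    have g: "(g, snd z) \<in> pverts (G \<circ>\<^sub>L H)"
      using that z(1) by (auto simp: pverts_lex_product)
    then have "distance G (fst z) (fst (g, snd z)) \<le> distance (G \<circ>\<^sub>L H) z (g, snd z)"
      using lex_product_path[OF assms(1) z(1)] distance_fst_le[OF D(1,2)] by blast
    also have "\<dots> \<le> R" using z(2) g by blast
    finally show ?thesis by simp
  qed
  moreover have "fst z \<in> pverts G" using z(1) by (auto simp: pverts_lex_product)
  ultimately obtain h0 h1 where "lex_levels G H (distance G (fst z)) R (fst z) h0 h1"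
    using lex_levels_distance[OF assms(1)] assms(3) by blast
  then show ?thesis
    by (rule lex_levels.rainbow_connection_number_le_2R)
qed

section \<open>Products with a universal vertex\<close>

text \<open>
  With \<open>z\<close> universal and all of \<open>P\<close> joined to all of \<open>Q\<close>, two vertices on the same side
  are linked by a path of length three through \<open>z\<close> and the other side.
\<close>

lemma rainbow_connection_number_le_3:
  assumes "pair_graph G" and "z \<in> pverts G"
    and "\<And>v. v \<in> pverts G \<Longrightarrow> v \<noteq> z \<Longrightarrow> (z, v) \<in> parcs G"
    and "pverts G - {z} = P \<union> Q" and "P \<inter> Q = {}" and "P \<noteq> {}" and "Q \<noteq> {}"
    and "\<And>p q. p \<in> P \<Longrightarrow> q \<in> Q \<Longrightarrow> (p, q) \<in> parcs G"
  shows "rainbow_connection_number G \<le> 3"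
proof -
  interpret pair_graph G by fact
  define f where "f v = (if v = z then 0 else if v \<in> P then 1 else 2 :: nat)" for v
  \<comment> \<open>Edges from \<open>z\<close> to \<open>P\<close> get color 0, edges from
    \<open>z\<close> to \<open>Q\<close> color 1, edges between \<open>P\<close> and
    \<open>Q\<close> color 2; edges inside \<open>P\<close> or \<open>Q\<close> get the default
    0.\<close>
  define c where "c = graded_coloring f (\<lambda>x y. if f x = 0 then f y - 1 else 2)"
  have f: "f z = 0" "\<And>p. p \<in> P \<Longrightarrow> f p = 1" "\<And>q. q \<in> Q \<Longrightarrow> f q = 2"
    using assms(4,5) by (auto simp: f_def)
  have c: "c {z, p} = 0" "c {p, z} = 0" "c {z, q} = 1" "c {q, z} = 1" "c {p, q} = 2" "c {q, p} = 2"
    if "p \<in> P" "q \<in> Q" for p q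
    using f that unfolding c_def by (simp_all add: graded_coloring_eq)
  have V: "p \<in> pverts G" "p \<noteq> z" if "p \<in> P \<union> Q" for p
    using that assms(4) by auto
  have arcs: "(z, v) \<in> parcs G" "(v, z) \<in> parcs G" if "v \<in> P \<union> Q" for v
    using assms(3) V[OF that] arcs_symmetric by blast+
  have arcs': "(p, q) \<in> parcs G" "(q, p) \<in> parcs G" if "p \<in> P" "q \<in> Q" for p q
    using assms(8)[OF that] arcs_symmetric by blast+
  obtain p0 q0 where pq: "p0 \<in> P" "q0 \<in> Q" using assms(6,7) by blast
  have single: "rainbow_linked G c u v" if "(u, v) \<in> parcs G" for u v
  proof (rule rainbow_linkedI)
    show "colored_walk G c u [c {u, v}] v"
      unfolding colored_walk.simps using that in_arcsD2 by blast
  qed simp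
  have "rainbow_coloring G c"
  proof (rule rainbow_coloringI[OF assms(1)])
    fix u v assume uv: "u \<in> pverts G" "v \<in> pverts G"
    consider "u = v" | "(u, v) \<in> parcs G" | "u \<in> P" "v \<in> P" | "u \<in> Q" "v \<in> Q"
    proof -
      have "u = z \<or> u \<in> P \<or> u \<in> Q" "v = z \<or> v \<in> P \<or> v \<in> Q"
        using uv assms(4) by blast+
      with that arcs[of u] arcs[of v] arcs'[of u v] arcs'[of v u] show thesis
        by (elim disjE) simp_all
    qed
    then show "rainbow_linked G c u v"
    proof cases
      case 1
      then show ?thesis using uv by (intro rainbow_linkedI[of _ _ _ "[]"]) auto
    next
      case 2
      then show ?thesis using single by simp
    next
      case 3
      then have "colored_walk G c u [0, 1, 2] v"
        unfolding colored_walk.simps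
        using pq uv arcs(2)[of u] arcs(1)[of q0] arcs'(2)[of v q0]
          c(2)[of u q0] c(3)[of u q0] c(6)[of v q0] by blast
      then show ?thesis by (rule rainbow_linkedI) simp
    next
      case 4
      then have "colored_walk G c u [1, 0, 2] v"
        unfolding colored_walk.simps
        using pq uv arcs(2)[of u] arcs(1)[of p0] arcs'(1)[of p0 v]
          c(4)[of p0 u] c(1)[of p0 u] c(5)[of p0 v] by blast
      then show ?thesis by (rule rainbow_linkedI) simp
    qed
  qed
  moreover have "c e < 3" if "e \<in> edges G" for e
    unfolding c_def using that by (rule graded_coloring_edge_lt) (auto simp: f_def)
  ultimately show ?thesis
    using rainbow_connection_number_le[of G c "{..<3}"] by auto
qed

text \<open>A center \<open>z\<close> is universal. Take \<open>P\<close> as the rest of its fiber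
  and \<open>Q\<close> as the union of all other fibers.\<close>

lemma rainbow_connection_number_lex_product_le_3:
  assumes "admissible_factors G H" and "radius (G \<circ>\<^sub>L H) \<le> 1"
  shows "rainbow_connection_number (G \<circ>\<^sub>L H) \<le> 3"
proof -
  note D = admissible_factorsD[OF assms(1)]
  interpret G: pair_graph G by (rule D)
  interpret H: pair_graph H by (rule D)
  interpret L: pair_graph "G \<circ>\<^sub>L H" by (rule D)
  obtain z where z: "z \<in> pverts (G \<circ>\<^sub>L H)" "\<forall>u\<in>pverts (G \<circ>\<^sub>L H). distance (G \<circ>\<^sub>L H) z u \<le> 1"
    using assms(2) D(5,6) by (auto simp: radius_le_iff pair_fin_digraph.pair_finite_verts)
  obtain g0 h0 where gh: "z = (g0, h0)" by (cases z)
  have univ: "(z, v) \<in> parcs (G \<circ>\<^sub>L H)" if "v \<in> pverts (G \<circ>\<^sub>L H)" "v \<noteq> z" for v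
    using lex_product_path[OF assms(1) z(1) that(1)] distance_le_1D[OF D(7)] z(2) that by metis
  obtain g1 where g1: "g1 \<in> pverts G" "g1 \<noteq> g0"
    using nontrivial_ex_other G.pair_finite_verts assms(1) by (metis admissible_factors_def)
  obtain h1 where h1: "h1 \<in> pverts H" "h1 \<noteq> h0"
    using nontrivial_ex_other H.pair_finite_verts assms(1) by (metis admissible_factors_def)
  have V: "g0 \<in> pverts G" "h0 \<in> pverts H" using z(1) gh by auto
  show ?thesis
  proof (rule rainbow_connection_number_le_3[OF D(3) z(1) univ])
    show "pverts (G \<circ>\<^sub>L H) - {z} =
        ({g0} \<times> (pverts H - {h0})) \<union> ((pverts G - {g0}) \<times> pverts H)"
      using V gh by (auto simp: pverts_lex_product)
    show "{g0} \<times> (pverts H - {h0}) \<noteq> {}" "(pverts G - {g0}) \<times> pverts H \<noteq> {}"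
      using g1 h1 by auto
    fix p q assume "p \<in> {g0} \<times> (pverts H - {h0})" and "q \<in> (pverts G - {g0}) \<times> pverts H"
    then obtain h g h' where pq: "p = (g0, h)" "q = (g, h')" "h \<in> pverts H" "h' \<in> pverts H"
      and g: "g \<in> pverts G" "g \<noteq> g0" by auto
    \<comment> \<open>Since \<open>g\<close> differs from \<open>g0\<close>, this edge must come
      from \<open>G\<close>. So \<open>g0\<close> is adjacent to \<open>g\<close>, and the whole
      fibers over them are joined.\<close>
    have "(z, (g, h0)) \<in> parcs (G \<circ>\<^sub>L H)"
      using univ[of "(g, h0)"] g V gh by auto
    then have "(g0, g) \<in> parcs G"
      using g gh by (auto simp: in_parcs_lex_product)
    then show "(p, q) \<in> parcs (G \<circ>\<^sub>L H)"
      using pq g V by (auto simp: in_parcs_lex_product)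
  qed auto
qed

lemma radius_pos:
  assumes "admissible_factors G H"
  shows "1 \<le> radius (G \<circ>\<^sub>L H)"
proof (rule ccontr)
  note D = admissible_factorsD[OF assms]
  assume "\<not> ?thesis"
  then have "radius (G \<circ>\<^sub>L H) \<le> 0" by simp
  then obtain z where z: "z \<in> pverts (G \<circ>\<^sub>L H)"
    "\<forall>u\<in>pverts (G \<circ>\<^sub>L H). distance (G \<circ>\<^sub>L H) z u \<le> 0"
    using D(5,6) by (auto simp: radius_le_iff pair_fin_digraph.pair_finite_verts simp del: le_zero_eq)
  obtain h where h: "h \<in> pverts H" "h \<noteq> snd z"
    using nontrivial_ex_other[of H "snd z"] assms D(2)
    by (auto simp: admissible_factors_def pair_graph_def pair_digraph_def pair_fin_digraph.pair_finite_verts)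
  then have "(fst z, h) \<in> pverts (G \<circ>\<^sub>L H)"
    using z(1) by (auto simp: pverts_lex_product)
  then have "z = (fst z, h)"
    using lex_product_path[OF assms z(1)] distance_eq_0D z(2) by (metis le_zero_eq)
  with h(2) show False by (metis snd_conv)
qed

section \<open>Sharpness\<close>

definition path5 :: "nat pair_pre_digraph" where
  "path5 = \<lparr>pverts = {..4}, parcs = {(i, j). i \<le> 4 \<and> j \<le> 4 \<and> (j = Suc i \<or> i = Suc j)}\<rparr>"

definition star5 :: "nat pair_pre_digraph" where
  "star5 = \<lparr>pverts = {..5}, parcs = {(i, j). i \<le> 5 \<and> j \<le> 5 \<and> (i = 0) \<noteq> (j = 0)}\<rparr>"

definition single_edge :: "nat pair_pre_digraph" where
  "single_edge = \<lparr>pverts = {..1}, parcs = {(0, 1), (1, 0)}\<rparr>"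

lemma pair_graphI:
  assumes "finite (pverts G)" and "parcs G \<subseteq> pverts G \<times> pverts G"
    and "\<And>u v. (u, v) \<in> parcs G \<Longrightarrow> u \<noteq> v \<and> (v, u) \<in> parcs G"
  shows "pair_graph G"
proof
  show "finite (parcs G)"
    using finite_subset[OF assms(2)] assms(1) by simp
  show "symmetric (with_proj G)"
    using assms(3) by (simp add: symmetric_def sym_def)
qed (use assms in auto)

lemma distance_le_1_if_arc:
  assumes "pair_wf_digraph G" and "(u, v) \<in> parcs G"
  shows "distance G u v \<le> 1"
proof -
  interpret pair_wf_digraph G by fact
  show ?thesis
    using distance_le_if_awalk[OF assms(1), of u "[(u, v)]" v] assms(2)
    by (simp add: awalk_simps wellformed')
qed

lemma distance_le_2_if_arcs:
  assumes "pair_wf_digraph G" and "(u, w) \<in> parcs G" and "(w, v) \<in> parcs G"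
  shows "distance G u v \<le> 2"
proof -
  interpret pair_wf_digraph G by fact
  show ?thesis
    using distance_le_if_awalk[OF assms(1), of u "[(u, w), (w, v)]" v] assms(2,3)
    by (simp add: awalk_simps wellformed')
qed

lemma pair_graph_single_edge: "pair_graph single_edge"
  by (rule pair_graphI) (auto simp: single_edge_def)

lemma admissible_path5: "admissible_factors path5 single_edge"
proof -
  have G: "pair_graph path5"
    by (rule pair_graphI) (auto simp: path5_def)
  interpret pair_graph path5 by (rule G)
  have "\<exists>p. awalk 0 p v" if "v \<in> pverts path5" for v
    using that
  proof (induction v)
    case 0
    then show ?case by (metis awalk_Nil_iff)
  next
    case (Suc v)
    then obtain p where "awalk 0 p v" by (auto simp: path5_def)
    moreover have "(v, Suc v) \<in> parcs path5" using Suc.prems by (simp add: path5_def)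
    ultimately have "awalk 0 (p @ [(v, Suc v)]) (Suc v)"
      by (auto simp: awalk_simps wellformed')
    then show ?case by blast
  qed
  then have "connected (with_proj path5)"
    by (intro connected_if_reachable_from[OF G, of 0]) (auto simp: path5_def)
  then show ?thesis
    using G pair_graph_single_edge
    by (simp add: admissible_factors_def trivial_graph_def path5_def single_edge_def)
qed

lemma admissible_star5: "admissible_factors star5 single_edge"
proof -
  have G: "pair_graph star5"
    by (rule pair_graphI) (auto simp: star5_def)
  interpret pair_graph star5 by (rule G)
  have "\<exists>p. awalk 0 p v" if "v \<in> pverts star5" for v
  proof (cases "v = 0")
    case True
    with that show ?thesis by (metis awalk_Nil_iff)
  next
    case False
    with that have "awalk 0 [(0, v)] v" by (simp add: awalk_simps) (simp add: star5_def)
    then show ?thesis by blast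
  qed
  then have "connected (with_proj star5)"
    by (intro connected_if_reachable_from[OF G, of 0]) (auto simp: star5_def)
  then show ?thesis
    using G pair_graph_single_edge
    by (simp add: admissible_factors_def trivial_graph_def star5_def single_edge_def)
qed

text \<open>The first coordinate is a potential: it moves by at most one along a path edge and not
  at all inside a fiber.\<close>

lemma distance_path5_ge:
  assumes "u \<in> pverts (path5 \<circ>\<^sub>L single_edge)" and "v \<in> pverts (path5 \<circ>\<^sub>L single_edge)"
  shows "\<bar>int (fst u) - int (fst v)\<bar> \<le> int (distance (path5 \<circ>\<^sub>L single_edge) u v)"
proof -
  obtain p where "path_in (path5 \<circ>\<^sub>L single_edge) u p v"
    using lex_product_path[OF admissible_path5 assms] by blast
  then show ?thesis
    by (rule le_distance_if_lipschitz[OF admissible_factorsD(7)[OF admissible_path5]])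
      (auto simp: lex_product_def path5_def)
qed

lemma radius_path5: "radius (path5 \<circ>\<^sub>L single_edge) = 2"
proof (rule antisym)
  let ?L = "path5 \<circ>\<^sub>L single_edge"
  note D = admissible_factorsD[OF admissible_path5]
  note iff = radius_le_iff[OF pair_fin_digraph.pair_finite_verts[OF D(6)] D(5)]
  have "distance ?L (2, 0) (g, h) \<le> 2" if "g \<le> 4" "h \<le> 1" for g h
  proof -
    have mem: "(a, b) \<in> pverts ?L" if "a \<le> 4" "b \<le> 1" for a b
      using that by (simp add: path5_def single_edge_def)
    have near: "distance ?L (2, 0) (g, h) \<le> 2" if "((2, 0), (g, h)) \<in> parcs ?L"
      using distance_le_1_if_arc[OF D(7) that] by simp
    consider "g = 0" | "g = 1" | "g = 2" "h = 0" | "g = 2" "h = 1" | "g = 3" | "g = 4"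
      using \<open>g \<le> 4\<close> \<open>h \<le> 1\<close> by linarith
    then show ?thesis
    proof cases
      case 1
      then show ?thesis using that
        by (intro distance_le_2_if_arcs[OF D(7), of _ "(1, 0)"])
          (auto simp: in_parcs_lex_product path5_def single_edge_def)
    next
      case 3
      then show ?thesis using distance_self[OF D(7) mem[of 2 0]] by simp
    next
      case 6
      then show ?thesis using that
        by (intro distance_le_2_if_arcs[OF D(7), of _ "(3, 0)"])
          (auto simp: in_parcs_lex_product path5_def single_edge_def)
    qed (rule near; use that in \<open>simp add: in_parcs_lex_product path5_def single_edge_def\<close>)+
  qed
  then show "radius ?L \<le> 2"
    unfolding iff by (intro bexI[of _ "(2, 0)"])
      (auto simp: pverts_lex_product path5_def single_edge_def)
  show "2 \<le> radius ?L"
  proof (rule ccontr)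
    assume "\<not> ?thesis"
    then have "radius ?L \<le> 1" by simp
    then obtain z where z: "z \<in> pverts ?L" "\<forall>u\<in>pverts ?L. distance ?L z u \<le> 1"
      unfolding iff by blast
    have "(0, 0) \<in> pverts ?L" "(4, 0) \<in> pverts ?L"
      by (simp_all add: path5_def single_edge_def)
    \<comment> \<open>A center of eccentricity one would have its first coordinate within one of
      both 0 and 4.\<close>
    then have "\<bar>int (fst z) - 0\<bar> \<le> 1" "\<bar>int (fst z) - 4\<bar> \<le> 1"
      using distance_path5_ge[OF z(1), of "(0, 0)"] distance_path5_ge[OF z(1), of "(4, 0)"] z(2)
      by fastforce+
    then show False by simp
  qed
qed

text \<open>The general upper bound at radius 2 meets the diameter bound: \<open>(0, 0)\<close> and
  \<open>(4, 0)\<close> are at distance at least 4.\<close>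

lemma rainbow_connection_number_path5:
  "rainbow_connection_number (path5 \<circ>\<^sub>L single_edge) = 4"
proof (rule antisym)
  let ?L = "path5 \<circ>\<^sub>L single_edge"
  note D = admissible_factorsD[OF admissible_path5]
  show "rainbow_connection_number ?L \<le> 4"
    using rainbow_connection_number_lex_product_le[OF admissible_path5, of 2] radius_path5 by simp
  obtain c where "rainbow_coloring ?L c"
    using ex_rainbow_coloring[OF admissible_path5] by blast
  then show "4 \<le> rainbow_connection_number ?L"
  proof (rule le_rainbow_connection_number)
    fix c assume c: "rainbow_coloring ?L c"
    have mem: "(0, 0) \<in> pverts ?L" "(4, 0) \<in> pverts ?L"
      by (simp_all add: path5_def single_edge_def)
    show "4 \<le> card (c ` edges ?L)"
      using distance_path5_ge[OF mem] distance_le_card_colors[OF D(6) c mem] by simp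
  qed
qed

lemma radius_star5: "radius (star5 \<circ>\<^sub>L single_edge) = 1"
proof (rule antisym)
  let ?L = "star5 \<circ>\<^sub>L single_edge"
  note D = admissible_factorsD[OF admissible_star5]
  have z: "(0, 0) \<in> pverts ?L" by (simp add: star5_def single_edge_def)
  have "distance ?L (0, 0) u \<le> 1" if "u \<in> pverts ?L" for u
  proof (cases "u = (0, 0)")
    case True
    then show ?thesis using distance_self[OF D(7) z] by simp
  next
    case False
    with that have "((0, 0), u) \<in> parcs ?L"
      by (cases u) (auto simp: in_parcs_lex_product star5_def single_edge_def)
    then show ?thesis by (rule distance_le_1_if_arc[OF D(7)])
  qed
  then show "radius ?L \<le> 1"
    unfolding radius_le_iff[OF pair_fin_digraph.pair_finite_verts[OF D(6)] D(5)] using z by blast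
  show "1 \<le> radius ?L" by (rule radius_pos[OF admissible_star5])
qed

lemma parcs_star5: "(i, j) \<in> parcs star5 \<longleftrightarrow> i \<le> 5 \<and> j \<le> 5 \<and> (i = 0) \<noteq> (j = 0)"
  by (simp add: star5_def)

text \<open>
  With two colors there are four ways to color the edges from a leaf vertex to the two central
  vertices, so two of the five leaves agree and no path of length two between them is rainbow.
\<close>

lemma three_le_card_colors_star5:
  assumes "rainbow_coloring (star5 \<circ>\<^sub>L single_edge) c"
  shows "3 \<le> card (c ` edges (star5 \<circ>\<^sub>L single_edge))"
proof (rule ccontr)
  let ?L = "star5 \<circ>\<^sub>L single_edge"
  let ?S = "c ` edges ?L"
  interpret L: pair_graph ?L by (rule admissible_factorsD(3)[OF admissible_star5])
  assume "\<not> ?thesis"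
  then have S: "card ?S \<le> 2" by simp
  define f where "f i = (c {(i, 0), (0, 0)}, c {(i, 0), (0, 1)})" for i :: nat
  have "((i, 0), (0, h)) \<in> parcs ?L" if "i \<in> {1..5}" "h \<le> 1" for i h
    using that by (auto simp: in_parcs_lex_product star5_def single_edge_def)
  then have "edge_of ((i, 0), (0, h)) \<in> edges ?L" if "i \<in> {1..5}" "h \<le> 1" for i h
    using that unfolding edges_def by (intro imageI)
  then have edge: "{(i, 0), (0, h)} \<in> edges ?L" if "i \<in> {1..5}" "h \<le> 1" for i h
    using that by (simp add: edge_of_def)
  have "f ` {1..5} \<subseteq> ?S \<times> ?S"
    using edge by (auto simp: f_def)
  then have "card (f ` {1..5}) \<le> card (?S \<times> ?S)"
    using finite_edges[OF L.pair_fin_digraph] by (intro card_mono) auto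
  also have "\<dots> \<le> 2 * 2"
    unfolding card_cartesian_product using S by (intro mult_le_mono)
  finally have "\<not> inj_on f {1..5}"
    using card_image[of f "{1..5}"] by force
  then obtain i j where ij: "i \<in> {1..5}" "j \<in> {1..5}" "f i = f j" "i \<noteq> j"
    by (auto simp: inj_on_def)
  have "(i, 0) \<in> pverts ?L" "(j, 0) \<in> pverts ?L"
    using ij by (auto simp: star5_def single_edge_def)
  then obtain p where p: "rainbow_path ?L c (i, 0) p (j, 0)"
    using assms unfolding rainbow_coloring_def by blast
  then have w: "L.awalk (i, 0) p (j, 0)" and d: "distinct (map (\<lambda>a. c (edge_of a)) p)"
    by (auto simp: rainbow_path_def L.apath_def)
  have "length p \<le> 2"
    using rainbow_path_length_le[OF L.pair_fin_digraph p] S by simp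
  moreover obtain e q where q: "p = e # q"
    using w ij(4) by (cases p) (auto simp: L.awalk_Nil_iff)
  \<comment> \<open>Vertices over different leaves are not adjacent, so one arc is not
    enough.\<close>
  moreover have "q \<noteq> []"
    using w ij q by (cases e) (auto simp: L.awalk_simps in_parcs_lex_product parcs_star5)
  ultimately obtain e' where p': "p = [e, e']"
    by (cases q) auto
  define x where "x = snd e"
  have e: "e \<in> parcs ?L \<and> e' \<in> parcs ?L \<and> fst e = (i, 0) \<and> fst e' = x \<and> snd e' = (j, 0)"
    using w p' by (simp add: L.awalk_simps x_def)
  then have x: "((i, 0), x) \<in> parcs ?L" "(x, (j, 0)) \<in> parcs ?L"
    by (metis prod.collapse x_def)+
  \<comment> \<open>The middle vertex lies over the center, since the other neighbor
    \<open>(i, 1)\<close> of \<open>(i, 0)\<close> is not adjacent to \<open>(j, 0)\<close>.\<close>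
  obtain h where "x = (0, h)" "h \<le> 1"
    using x ij by (cases x) (auto simp: in_parcs_lex_product parcs_star5 single_edge_def)
  then have "c {(i, 0), x} = c {x, (j, 0)}"
    using ij(3) by (cases h) (auto simp: f_def insert_commute)
  with d e show False by (simp add: p' edge_of_def x_def)
qed

lemma rainbow_connection_number_star5:
  "rainbow_connection_number (star5 \<circ>\<^sub>L single_edge) = 3"
proof (rule antisym)
  show "rainbow_connection_number (star5 \<circ>\<^sub>L single_edge) \<le> 3"
    using rainbow_connection_number_lex_product_le_3[OF admissible_star5] radius_star5 by simp
  show "3 \<le> rainbow_connection_number (star5 \<circ>\<^sub>L single_edge)"
    using ex_rainbow_coloring[OF admissible_star5] three_le_card_colors_star5
      le_rainbow_connection_number by metis
qed

lemma radius_le_rainbow_connection_number_lex_product: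
  assumes "admissible_factors G H"
  shows "radius (G \<circ>\<^sub>L H) \<le> rainbow_connection_number (G \<circ>\<^sub>L H)"
  using ex_rainbow_coloring[OF assms] radius_le_rainbow_connection_number
    admissible_factorsD(5,6)[OF assms] by blast

theorem theorem3:
  shows
    "(\<forall>(G' :: 'a pair_pre_digraph) (H :: 'b pair_pre_digraph).
        admissible_factors G' H \<and> radius (G' \<circ>\<^sub>L H) \<ge> 2 \<longrightarrow>
          radius (G' \<circ>\<^sub>L H) \<le> rainbow_connection_number (G' \<circ>\<^sub>L H) \<and>
          rainbow_connection_number (G' \<circ>\<^sub>L H) \<le> 2 * radius (G' \<circ>\<^sub>L H))
     \<and> (\<exists>(G' :: nat pair_pre_digraph) (H :: nat pair_pre_digraph).
        admissible_factors G' H \<and> radius (G' \<circ>\<^sub>L H) \<ge> 2 \<and>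
          rainbow_connection_number (G' \<circ>\<^sub>L H) = 2 * radius (G' \<circ>\<^sub>L H))
     \<and> (\<forall>(G' :: 'a pair_pre_digraph) (H :: 'b pair_pre_digraph).
        admissible_factors G' H \<and> radius (G' \<circ>\<^sub>L H) = 1 \<longrightarrow>
          1 \<le> rainbow_connection_number (G' \<circ>\<^sub>L H) \<and>
          rainbow_connection_number (G' \<circ>\<^sub>L H) \<le> 3)
     \<and> (\<exists>(G' :: nat pair_pre_digraph) (H :: nat pair_pre_digraph).
        admissible_factors G' H \<and> radius (G' \<circ>\<^sub>L H) = 1 \<and>
          rainbow_connection_number (G' \<circ>\<^sub>L H) = 3)"
proof (intro conjI allI impI)
  fix G' :: "'a pair_pre_digraph" and H :: "'b pair_pre_digraph"
  assume A: "admissible_factors G' H \<and> radius (G' \<circ>\<^sub>L H) \<ge> 2"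
  then show "radius (G' \<circ>\<^sub>L H) \<le> rainbow_connection_number (G' \<circ>\<^sub>L H)"
    by (simp add: radius_le_rainbow_connection_number_lex_product)
  from A show "rainbow_connection_number (G' \<circ>\<^sub>L H) \<le> 2 * radius (G' \<circ>\<^sub>L H)"
    by (simp add: rainbow_connection_number_lex_product_le)
next
  show "\<exists>(G' :: nat pair_pre_digraph) (H :: nat pair_pre_digraph).
        admissible_factors G' H \<and> radius (G' \<circ>\<^sub>L H) \<ge> 2 \<and>
          rainbow_connection_number (G' \<circ>\<^sub>L H) = 2 * radius (G' \<circ>\<^sub>L H)"
    using admissible_path5 radius_path5 rainbow_connection_number_path5
    by (intro exI[of _ path5] exI[of _ single_edge]) simp
next
  fix G' :: "'a pair_pre_digraph" and H :: "'b pair_pre_digraph"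
  assume A: "admissible_factors G' H \<and> radius (G' \<circ>\<^sub>L H) = 1"
  then show "1 \<le> rainbow_connection_number (G' \<circ>\<^sub>L H)"
    using radius_le_rainbow_connection_number_lex_product[of G' H] by simp
  from A show "rainbow_connection_number (G' \<circ>\<^sub>L H) \<le> 3"
    by (simp add: rainbow_connection_number_lex_product_le_3)
next
  show "\<exists>(G' :: nat pair_pre_digraph) (H :: nat pair_pre_digraph).
        admissible_factors G' H \<and> radius (G' \<circ>\<^sub>L H) = 1 \<and>
          rainbow_connection_number (G' \<circ>\<^sub>L H) = 3"
    using admissible_star5 radius_star5 rainbow_connection_number_star5 by blast
qed

end
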